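(* Let $h:\mathbb{R}_+\to\mathbb{R}$ be monotonically increasing and convex. For $A\in\mathbb{P}_n$ let $\lambda^\downarrow_1(A)\ge\cdots\ge\lambda^\downarrow_n(A)$ be its eigenvalues sorted decreasingly. Then for each $1\le k\le n$ the function $A\mapsto \sum_{j=1}^k h(\lambda_j^\downarrow(A))$ is geodesically convex on $\mathbb{P}_n$.
   Context: $\mathbb{P}_n$ denotes the set of $n\times n$ Hermitian positive definite matrices. For $A,B\in\mathbb{P}_n$ and $t\in[0,1]$, $A\#_t B:=A^{1/2}(A^{-1/2}BA^{-1/2})^tA^{1/2}$ (the geodesic from $A$ to $B$ for the Riemannian metric $ds=\|A^{-1/2}dA\,A^{-1/2}\|_F$). A function $\phi$ on $\mathbb{P}_n$ is geodesically convex (g-convex) if $\phi(A\#_tB)\le(1-t)\phi(A)+t\phi(B)$ for all $A,B\in\mathbb{P}_n$, $t\in[0,1]$. *)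

theory Defs
  imports "HOL-Analysis.Analysis" "Jordan_Normal_Form.Char_Poly"
begin

definition cadj :: "complex mat \<Rightarrow> complex mat" where
  "cadj A = mat (dim_col A) (dim_row A) (\<lambda>(i,j). cnj (A $$ (j,i)))"

definition hermitian_mat :: "nat \<Rightarrow> complex mat \<Rightarrow> bool" where
  "hermitian_mat n A \<longleftrightarrow> A \<in> carrier_mat n n \<and> cadj A = A"

definition posdef_mats :: "nat \<Rightarrow> complex mat set" where
  "posdef_mats n = {A. hermitian_mat n A \<and>
     (\<forall>v \<in> carrier_vec n. v \<noteq> 0\<^sub>v n \<longrightarrow> Re (conjugate v \<bullet> (A *\<^sub>v v)) > 0)}"

definition unitary_mat :: "nat \<Rightarrow> complex mat \<Rightarrow> bool" where
  "unitary_mat n U \<longleftrightarrow> U \<in> carrier_mat n n \<and> cadj U * U = 1\<^sub>m n"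

definition rdiag_mat :: "nat \<Rightarrow> (nat \<Rightarrow> real) \<Rightarrow> complex mat" where
  "rdiag_mat n d = mat n n (\<lambda>(i,j). if i = j then complex_of_real (d i) else 0)"

text \<open>Real power A^t of a positive definite matrix via its spectral decomposition
  A = U diag(d) U^*, A^t = U diag(d^t) U^* (well defined, independent of the decomposition).\<close>
definition mat_powr :: "nat \<Rightarrow> complex mat \<Rightarrow> real \<Rightarrow> complex mat" where
  "mat_powr n A t = (THE X. \<exists>U d. unitary_mat n U \<and> (\<forall>i<n. d i > 0) \<and>
      A = U * rdiag_mat n d * cadj U \<and> X = U * rdiag_mat n (\<lambda>i. d i powr t) * cadj U)"

definition geo :: "nat \<Rightarrow> real \<Rightarrow> complex mat \<Rightarrow> complex mat \<Rightarrow> complex mat" where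
  "geo n t A B = mat_powr n A (1/2) *
     mat_powr n (mat_powr n A (-1/2) * B * mat_powr n A (-1/2)) t * mat_powr n A (1/2)"

definition g_convex :: "nat \<Rightarrow> (complex mat \<Rightarrow> real) \<Rightarrow> bool" where
  "g_convex n \<phi> \<longleftrightarrow> (\<forall>A \<in> posdef_mats n. \<forall>B \<in> posdef_mats n. \<forall>t::real. 0 \<le> t \<and> t \<le> 1 \<longrightarrow>
      \<phi> (geo n t A B) \<le> (1 - t) * \<phi> A + t * \<phi> B)"

text \<open>Eigenvalues of a Hermitian matrix (real), with algebraic multiplicity
  (root multiplicity in the characteristic polynomial), sorted decreasingly.
  Index 0 of the list is lambda_1.\<close>
definition eigs_desc :: "nat \<Rightarrow> complex mat \<Rightarrow> real list" where
  "eigs_desc n A = (THE xs. length xs = n \<and> sorted_wrt (\<ge>) xs \<and>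
      (\<forall>x. count (mset xs) x = order (complex_of_real x) (char_poly A)))"

end

theory Submission
  imports Defs "Jordan_Normal_Form.Schur_Decomposition"
begin

text \<open>
  The operator arithmetic--geometric mean inequality gives \<open>G \<le> (1 - t) A + t B\<close> for
  \<open>G = A #\<^sub>t B\<close>. Let \<open>u\<^sub>1, \<dots>, u\<^sub>k\<close> be orthonormal eigenvectors for the \<open>k\<close> largest eigenvalues of \<open>G\<close>.
  Then \<open>\<lambda>\<^sub>j(G) = u\<^sub>j\<^sup>* G u\<^sub>j \<le> (1 - t) u\<^sub>j\<^sup>* A u\<^sub>j + t u\<^sub>j\<^sup>* B u\<^sub>j\<close>, so, \<open>h\<close> being increasing and
  convex, it remains to see that \<open>h(u\<^sub>1\<^sup>* A u\<^sub>1) + \<dots> + h(u\<^sub>k\<^sup>* A u\<^sub>k)\<close> is at most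
  \<open>h(\<lambda>\<^sub>1(A)) + \<dots> + h(\<lambda>\<^sub>k(A))\<close>. For an orthonormal eigenbasis \<open>v\<^sub>i\<close> of \<open>A\<close> the numbers
  \<open>|v\<^sub>i\<^sup>* u\<^sub>j|\<^sup>2\<close> form part of a doubly stochastic matrix. Jensen's inequality therefore bounds the
  left-hand side by a combination of the \<open>h(\<lambda>\<^sub>i(A))\<close> with weights in \<open>[0,1]\<close> of total mass \<open>k\<close>, and
  such a combination is largest when the weights sit on the top \<open>k\<close> values.
\<close>

unbundle no inner_syntax

section \<open>Adjoints and the Hermitian inner product\<close>

lemma mult_carrier_mat_square [simp]:
  "A \<in> carrier_mat n n \<Longrightarrow> B \<in> carrier_mat n n \<Longrightarrow> A * B \<in> carrier_mat n n"
  by simp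

lemma mult_mat_vec_carrier_square [simp]:
  "A \<in> carrier_mat n n \<Longrightarrow> v \<in> carrier_vec n \<Longrightarrow> A *\<^sub>v v \<in> carrier_vec n"
  by simp

lemma mult_mat_zero_vec:
  fixes A :: "'a :: semiring_0 mat"
  assumes "A \<in> carrier_mat m n"
  shows "A *\<^sub>v 0\<^sub>v n = 0\<^sub>v m"
  using assms by (intro eq_vecI) (auto simp: scalar_prod_def)

lemma cadj_carrier [simp]: "A \<in> carrier_mat m n \<Longrightarrow> cadj A \<in> carrier_mat n m"
  by (auto simp: cadj_def)

lemma dim_cadj [simp]: "dim_row (cadj A) = dim_col A" "dim_col (cadj A) = dim_row A"
  by (auto simp: cadj_def)

lemma index_cadj [simp]:
  "i < dim_col A \<Longrightarrow> j < dim_row A \<Longrightarrow> cadj A $$ (i,j) = cnj (A $$ (j,i))"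
  by (auto simp: cadj_def)

lemma cadj_cadj [simp]: "cadj (cadj A) = A"
  by (rule eq_matI) auto

lemma cadj_mult:
  assumes "A \<in> carrier_mat l m" "B \<in> carrier_mat m n"
  shows "cadj (A * B) = cadj B * cadj A"
  using assms by (intro eq_matI) (auto simp: scalar_prod_def mult.commute)

text \<open>Since \<open>\<bullet>\<close> is bilinear, the Hermitian inner product is written
  \<open>conjugate u \<bullet> v\<close>. Conjugating the adjoint gives the transpose, so the
  adjoint rule comes from the bilinear rule for transposes.\<close>

lemma cscalar_prod_mult_mat_vec:
  assumes "A \<in> carrier_mat m n" "u \<in> carrier_vec m" "v \<in> carrier_vec n"
  shows "conjugate u \<bullet> (A *\<^sub>v v) = conjugate (cadj A *\<^sub>v u) \<bullet> v"
proof -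
  have "conjugate (cadj A *\<^sub>v u) = transpose_mat A *\<^sub>v conjugate u"
    using assms by (intro eq_vecI) (auto simp: scalar_prod_def)
  then show ?thesis
    using transpose_vec_mult_scalar[of A m n v "conjugate u"] assms by simp
qed

lemma cscalar_prod_self:
  fixes v :: "complex vec"
  assumes "v \<in> carrier_vec n"
  shows "conjugate v \<bullet> v = of_real (\<Sum>i<n. (cmod (v $ i))\<^sup>2)"
  using assms
  by (auto simp: scalar_prod_def atLeast0LessThan mult.commute complex_norm_square
      simp del: of_real_power intro!: sum.cong)

section \<open>Unitary matrices\<close>

lemma unitary_mat_carrier: "unitary_mat n U \<Longrightarrow> U \<in> carrier_mat n n"
  by (simp add: unitary_mat_def)

lemma unitary_mat_right_inverse:
  assumes "unitary_mat n U"
  shows "U * cadj U = 1\<^sub>m n"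
  using assms mat_mult_left_right_inverse[of "cadj U" n U] by (auto simp: unitary_mat_def)

lemma unitary_mat_cadj:
  assumes "unitary_mat n U"
  shows "unitary_mat n (cadj U)"
  using assms unitary_mat_right_inverse[OF assms] by (auto simp: unitary_mat_def)

text \<open>For products associated to the right, where \<open>cadj U * U\<close> does not occur as
  a subterm and has to be cancelled in front of a further factor.\<close>

lemma mult_cadj_cancel [simp]:
  assumes "unitary_mat n U" "B \<in> carrier_mat n m"
  shows "cadj U * (U * B) = B" "U * (cadj U * B) = B"
proof -
  note U = unitary_mat_carrier[OF assms(1)]
  show "cadj U * (U * B) = B"
    using assms U by (subst assoc_mult_mat[symmetric, of _ n n]) (auto simp: unitary_mat_def)
  show "U * (cadj U * B) = B"
    using assms U by (subst assoc_mult_mat[symmetric, of _ n n])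
      (auto simp: unitary_mat_right_inverse)
qed

lemma unitary_mat_mult:
  assumes "unitary_mat n U" "unitary_mat n V"
  shows "unitary_mat n (U * V)"
proof -
  note [simp] = unitary_mat_carrier[OF assms(1)] unitary_mat_carrier[OF assms(2)]
  have "cadj (U * V) * (U * V) = cadj V * (cadj U * (U * V))"
    by (simp add: cadj_mult[of _ n n _ n] assoc_mult_mat[of _ n n _ n _ n])
  also have "\<dots> = 1\<^sub>m n"
    using assms by (subst mult_cadj_cancel[OF assms(1), of _ n]) (auto simp: unitary_mat_def)
  finally show ?thesis by (simp add: unitary_mat_def)
qed

text \<open>Together with its row counterpart this makes the squared moduli of the entries of a
  unitary matrix doubly stochastic.\<close>

lemma unitary_mat_col_norm:
  assumes "unitary_mat n U" "j < n"
  shows "(\<Sum>i<n. (cmod (U $$ (i,j)))\<^sup>2) = 1"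
proof -
  note U = unitary_mat_carrier[OF assms(1)]
  have "of_real (\<Sum>i<n. (cmod (U $$ (i,j)))\<^sup>2) = (cadj U * U) $$ (j,j)"
    using U assms(2)
    by (auto simp: scalar_prod_def atLeast0LessThan mult.commute complex_norm_square
      simp del: of_real_power intro!: sum.cong)
  also have "\<dots> = 1"
    using assms by (simp add: unitary_mat_def)
  finally show ?thesis using of_real_eq_1_iff by blast
qed

lemma unitary_mat_row_norm:
  assumes "unitary_mat n U" "i < n"
  shows "(\<Sum>j<n. (cmod (U $$ (i,j)))\<^sup>2) = 1"
  using unitary_mat_col_norm[OF unitary_mat_cadj[OF assms(1)] assms(2)]
    unitary_mat_carrier[OF assms(1)] assms(2) by simp

section \<open>Real diagonal matrices\<close>

lemma rdiag_mat_carrier [simp]: "rdiag_mat n d \<in> carrier_mat n n"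
  by (simp add: rdiag_mat_def)

lemma cadj_rdiag_mat [simp]: "cadj (rdiag_mat n d) = rdiag_mat n d"
  by (rule eq_matI) (auto simp: rdiag_mat_def)

lemma rdiag_mat_mult: "rdiag_mat n d * rdiag_mat n e = rdiag_mat n (\<lambda>i. d i * e i)"
  by (rule eq_matI)
    (auto simp: rdiag_mat_def scalar_prod_def if_distrib[of "\<lambda>x. x * _"] sum.delta cong: if_cong)

lemma mult_rdiag_mat_index:
  assumes "A \<in> carrier_mat n n" "i < n" "j < n"
  shows "(A * rdiag_mat n d) $$ (i,j) = A $$ (i,j) * of_real (d j)"
    and "(rdiag_mat n d * A) $$ (i,j) = of_real (d i) * A $$ (i,j)"
proof -
  show "(A * rdiag_mat n d) $$ (i,j) = A $$ (i,j) * of_real (d j)"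
    using assms by (auto simp: rdiag_mat_def scalar_prod_def atLeast0LessThan
        if_distrib[of "\<lambda>x. _ * x"] cong: if_cong)
  show "(rdiag_mat n d * A) $$ (i,j) = of_real (d i) * A $$ (i,j)"
    using assms by (auto simp: rdiag_mat_def scalar_prod_def atLeast0LessThan
        if_distrib[of "\<lambda>x. x * _"] cong: if_cong)
qed

lemma cscalar_prod_rdiag_mat:
  assumes "v \<in> carrier_vec n"
  shows "conjugate v \<bullet> (rdiag_mat n d *\<^sub>v v) = of_real (\<Sum>i<n. d i * (cmod (v $ i))\<^sup>2)"
proof -
  have "(rdiag_mat n d *\<^sub>v v) $ i = of_real (d i) * v $ i" if "i < n" for i
    using assms that by (auto simp: rdiag_mat_def scalar_prod_def atLeast0LessThan
        if_distrib[of "\<lambda>x. x * _"] cong: if_cong)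
  then show ?thesis
    using assms
    by (auto simp: scalar_prod_def atLeast0LessThan mult_ac complex_norm_square rdiag_mat_def
        simp del: of_real_power intro!: sum.cong)
qed

section \<open>Unitary conjugates of diagonal matrices and their real powers\<close>

text \<open>Moving \<open>V\<close> to the left argument makes the form diagonal in the coordinates
  \<open>cadj V *\<^sub>v v\<close>. Inequalities between quadratic forms thereby reduce to
  inequalities between real numbers.\<close>

lemma cscalar_prod_unitary_diag:
  assumes "unitary_mat n V" "v \<in> carrier_vec n"
  shows "conjugate v \<bullet> ((V * rdiag_mat n d * cadj V) *\<^sub>v v) =
    of_real (\<Sum>i<n. d i * (cmod ((cadj V *\<^sub>v v) $ i))\<^sup>2)"
proof -
  note [simp] = unitary_mat_carrier[OF assms(1)] assms(2)
  have "(V * rdiag_mat n d * cadj V) *\<^sub>v v = V *\<^sub>v (rdiag_mat n d *\<^sub>v (cadj V *\<^sub>v v))"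
    by (simp add: assoc_mult_mat_vec[of _ n n _ n] del: assoc_mult_mat_vec)
  then have "conjugate v \<bullet> ((V * rdiag_mat n d * cadj V) *\<^sub>v v) =
    conjugate (cadj V *\<^sub>v v) \<bullet> (rdiag_mat n d *\<^sub>v (cadj V *\<^sub>v v))"
    by (metis assms(2) cadj_carrier cscalar_prod_mult_mat_vec mult_mat_vec_carrier
        rdiag_mat_carrier unitary_mat_carrier[OF assms(1)])
  also have "\<dots> = of_real (\<Sum>i<n. d i * (cmod ((cadj V *\<^sub>v v) $ i))\<^sup>2)"
    by (intro cscalar_prod_rdiag_mat mult_mat_vec_carrier[of _ n n]) auto
  finally show ?thesis .
qed

lemma hermitian_unitary_diag:
  assumes "unitary_mat n V"
  shows "hermitian_mat n (V * rdiag_mat n d * cadj V)"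
proof -
  note [simp] = unitary_mat_carrier[OF assms(1)]
  show ?thesis
    by (simp add: hermitian_mat_def cadj_mult[of _ n n _ n] assoc_mult_mat[of _ n n _ n _ n])
qed

text \<open>The matrix \<open>W = V\<^sup>* U\<close> intertwines the two diagonal matrices, so \<open>W i j = 0\<close> unless
  \<open>d j = e i\<close>; hence it also intertwines \<open>f d\<close> and \<open>f e\<close>.\<close>

lemma unitary_diag_fun_cong:
  assumes U: "unitary_mat n U" and V: "unitary_mat n V"
    and eq: "U * rdiag_mat n d * cadj U = V * rdiag_mat n e * cadj V"
  shows "U * rdiag_mat n (\<lambda>i. f (d i)) * cadj U = V * rdiag_mat n (\<lambda>i. f (e i)) * cadj V"
proof -
  note [simp] = unitary_mat_carrier[OF U] unitary_mat_carrier[OF V]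
    mult_cadj_cancel[OF U, where m = n] mult_cadj_cancel[OF V, where m = n]
    assoc_mult_mat[of _ n n _ n _ n]
  define W where "W = cadj V * U"
  have W[simp]: "W \<in> carrier_mat n n" by (simp add: W_def)
  have "cadj V * (U * rdiag_mat n d * cadj U) * U = cadj V * (V * rdiag_mat n e * cadj V) * U"
    by (simp only: eq)
  then have inter: "W * rdiag_mat n d = rdiag_mat n e * W"
    using U right_mult_one_mat[of "rdiag_mat n d" n n] by (simp add: W_def unitary_mat_def)
  have "W * rdiag_mat n (\<lambda>i. f (d i)) = rdiag_mat n (\<lambda>i. f (e i)) * W"
  proof (rule eq_matI)
    fix i j assume "i < dim_row (rdiag_mat n (\<lambda>i. f (e i)) * W)"
      "j < dim_col (rdiag_mat n (\<lambda>i. f (e i)) * W)"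
    then have ij: "i < n" "j < n" using W by (auto simp: rdiag_mat_def)
    have "W $$ (i,j) * of_real (d j) = of_real (e i) * W $$ (i,j)"
      using mult_rdiag_mat_index[OF W ij] inter by metis
    then have "W $$ (i,j) * of_real (f (d j)) = of_real (f (e i)) * W $$ (i,j)"
      by auto
    then show "(W * rdiag_mat n (\<lambda>i. f (d i))) $$ (i,j) = (rdiag_mat n (\<lambda>i. f (e i)) * W) $$ (i,j)"
      using mult_rdiag_mat_index[OF W ij] by simp
  qed (use carrier_matD[OF W] in \<open>auto simp: rdiag_mat_def\<close>)
  then have "V * (W * rdiag_mat n (\<lambda>i. f (d i))) * cadj U = V * (rdiag_mat n (\<lambda>i. f (e i)) * W) * cadj U"
    by simp
  then show ?thesis
    by (simp add: W_def unitary_mat_right_inverse[OF U] right_mult_one_mat[of _ n])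
qed

text \<open>A spectral decomposition is not unique, so the description in \<open>mat_powr\<close>
  denotes a matrix only if all decompositions yield the same power; this is
  \<open>unitary_diag_fun_cong\<close> for the function \<open>x powr t\<close>.\<close>

lemma mat_powr_unitary_diag:
  assumes U: "unitary_mat n U" and d: "\<And>i. i < n \<Longrightarrow> d i > 0"
  shows "mat_powr n (U * rdiag_mat n d * cadj U) t = U * rdiag_mat n (\<lambda>i. d i powr t) * cadj U"
  unfolding mat_powr_def
proof (rule the_equality)
  fix X
  assume "\<exists>V e. unitary_mat n V \<and> (\<forall>i<n. e i > 0) \<and>
    U * rdiag_mat n d * cadj U = V * rdiag_mat n e * cadj V \<and>
    X = V * rdiag_mat n (\<lambda>i. e i powr t) * cadj V"
  then obtain V e where "unitary_mat n V" 
    "U * rdiag_mat n d * cadj U = V * rdiag_mat n e * cadj V"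
    "X = V * rdiag_mat n (\<lambda>i. e i powr t) * cadj V" by blast
  then show "X = U * rdiag_mat n (\<lambda>i. d i powr t) * cadj U"
    using unitary_diag_fun_cong[OF U, where f = "\<lambda>x. x powr t"] by simp
qed (use assms in blast)

section \<open>The spectral theorem for Hermitian matrices\<close>

lemma hermitian_eigenvalue_real:
  assumes A: "hermitian_mat n A" and "eigenvalue A e"
  shows "e \<in> \<real>"
proof -
  have Ac: "A \<in> carrier_mat n n" and adj: "cadj A = A"
    using A by (auto simp: hermitian_mat_def)
  obtain v where v: "v \<in> carrier_vec n" "v \<noteq> 0\<^sub>v n" and ev: "A *\<^sub>v v = e \<cdot>\<^sub>v v"
    using assms(2) Ac by (auto simp: eigenvalue_def eigenvector_def)
  have nz: "conjugate v \<bullet> v \<noteq> 0"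
    using v conjugate_square_eq_0_vec[of v n] conjugate_vec_sprod_comm[of v n v] by auto
  have "e * (conjugate v \<bullet> v) = conjugate v \<bullet> (A *\<^sub>v v)"
    using v by (simp add: ev)
  also have "\<dots> = conjugate (A *\<^sub>v v) \<bullet> v"
    using cscalar_prod_mult_mat_vec[OF Ac v(1) v(1)] adj by simp
  also have "\<dots> = cnj e * (conjugate v \<bullet> v)"
    using v by (simp add: ev conjugate_smult_vec)
  finally have "e = cnj e" using nz by simp
  then show ?thesis using Reals_cnj_iff by metis
qed

text \<open>Complete \<open>v\<close> to a basis, orthogonalise by Gram-Schmidt, which leaves the
  first vector unchanged, and normalise. The scalar \<open>c\<close> is the normalising factor of
  \<open>v\<close>.\<close>

lemma ex_unitary_mat_first_col:
  assumes v: "v \<in> carrier_vec n" "v \<noteq> 0\<^sub>v n"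
  obtains W c where "unitary_mat n W" "col W 0 = c \<cdot>\<^sub>v v"
proof -
  interpret cof_vec_space n "TYPE(complex)" .
  define b where "b = basis_completion v"
  define ws where "ws = gram_schmidt n b"
  have n: "n \<noteq> 0" using v by auto
  from basis_completion[OF v, folded b_def]
  have dist_b: "distinct b" and indep: "\<not> lin_dep (set b)" and b: "set b \<subseteq> carrier_vec n"
    and hdb: "hd b = v" and len_b: "length b = n" by auto
  from hdb len_b n obtain vs where bv: "b = v # vs" by (cases b) auto
  from gram_schmidt_result[OF b dist_b indep refl, folded ws_def]
  have ws: "set ws \<subseteq> carrier_vec n" "corthogonal ws" "length ws = n"
    by (auto simp: len_b)
  from gram_schmidt_hd[OF v(1), of vs, folded bv] have "hd ws = v" unfolding ws_def .
  then have ws0: "ws ! 0 = v" using ws(3) n by (simp add: hd_conv_nth[symmetric] flip: length_greater_0_conv)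
  have wsc: "ws ! j \<in> carrier_vec n" if "j < n" for j using ws that by auto
  define r where "r j = sqrt (\<Sum>i<n. (cmod (ws ! j $ i))\<^sup>2)" for j
  have self: "conjugate (ws ! j) \<bullet> (ws ! j) = of_real ((r j)\<^sup>2)" if "j < n" for j
    using cscalar_prod_self[OF wsc[OF that]] by (simp add: r_def sum_nonneg)
  \<comment> \<open>\<open>corthogonal\<close> conjugates the second factor, hence the exchanged
    indices. Being an equivalence, it also shows for \<open>i = j\<close> that the vectors have
    nonzero length.\<close>
  have orth: "conjugate (ws ! i) \<bullet> (ws ! j) = 0 \<longleftrightarrow> i \<noteq> j" if "i < n" "j < n" for i j
    using corthogonalD[OF ws(2), of j i] ws(3) that
      conjugate_vec_sprod_comm[OF wsc[OF that(2)] wsc[OF that(1)]] by auto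
  have rnz: "r j \<noteq> 0" if "j < n" for j
    using orth[OF that that] self[OF that] by auto
  define W where "W = mat n n (\<lambda>(i,j). ws ! j $ i / of_real (r j))"
  have Wc: "W \<in> carrier_mat n n" by (simp add: W_def)
  have colW: "col W j = (1 / of_real (r j)) \<cdot>\<^sub>v ws ! j" if "j < n" for j
    using that wsc[OF that] by (intro eq_vecI) (auto simp: W_def)
  have "cadj W * W = 1\<^sub>m n"
  proof (rule eq_matI)
    fix i j assume "i < dim_row (1\<^sub>m n)" "j < dim_col (1\<^sub>m n)"
    then have ij: "i < n" "j < n" by auto
    have "(cadj W * W) $$ (i,j) = conjugate (col W i) \<bullet> col W j"
      using ij Wc by (auto simp: scalar_prod_def intro!: sum.cong)
    also have "\<dots> = (conjugate (ws ! i) \<bullet> (ws ! j)) / of_real (r i * r j)"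
      using colW ij wsc[OF ij(1)] wsc[OF ij(2)]
      by (simp add: conjugate_smult_vec smult_scalar_prod_distrib[of _ n]
          scalar_prod_smult_distrib[of _ n])
    also have "\<dots> = 1\<^sub>m n $$ (i,j)"
      using orth[OF ij] self[OF ij(1)] ij rnz by (cases "i = j") (auto simp: power2_eq_square)
    finally show "(cadj W * W) $$ (i,j) = 1\<^sub>m n $$ (i,j)" .
  qed (auto simp: W_def)
  then have "unitary_mat n W" using Wc by (simp add: unitary_mat_def)
  then show thesis using that colW[of 0] n ws0 by auto
qed

lemma cadj_four_block_mat_diag:
  assumes "U \<in> carrier_mat m m"
  shows "cadj (four_block_mat (1\<^sub>m 1) (0\<^sub>m 1 m) (0\<^sub>m m 1) U) =
    four_block_mat (1\<^sub>m 1) (0\<^sub>m 1 m) (0\<^sub>m m 1) (cadj U)"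
  using assms by (intro eq_matI) auto

lemma mult_four_block_mat_diag:
  fixes A1 :: "'a :: semiring_1 mat"
  assumes "A1 \<in> carrier_mat l l" "A2 \<in> carrier_mat m m" "B1 \<in> carrier_mat l l" "B2 \<in> carrier_mat m m"
  shows "four_block_mat A1 (0\<^sub>m l m) (0\<^sub>m m l) A2 * four_block_mat B1 (0\<^sub>m l m) (0\<^sub>m m l) B2 =
    four_block_mat (A1 * B1) (0\<^sub>m l m) (0\<^sub>m m l) (A2 * B2)"
proof -
  note c = assms zero_carrier_mat[of l m] zero_carrier_mat[of m l]
  show ?thesis
    using assms
    by (simp add: mult_four_block_mat[OF c(1) c(5) c(6) c(2) c(3) c(5) c(6) c(4)]
        left_mult_zero_mat[of _ _ l] left_mult_zero_mat[of _ _ m]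
        right_mult_zero_mat[of _ _ l] right_mult_zero_mat[of _ _ m])
qed

lemma unitary_mat_four_block:
  assumes "unitary_mat m U"
  shows "unitary_mat (Suc m) (four_block_mat (1\<^sub>m 1) (0\<^sub>m 1 m) (0\<^sub>m m 1) U)"
proof -
  note U = unitary_mat_carrier[OF assms]
  let ?F = "\<lambda>U. four_block_mat (1\<^sub>m 1) (0\<^sub>m 1 m) (0\<^sub>m m 1) U :: complex mat"
  have "cadj (?F U) * ?F U = ?F (cadj U) * ?F U"
    using cadj_four_block_mat_diag[OF U] by simp
  also have "\<dots> = ?F (1\<^sub>m m)"
    using U assms by (subst mult_four_block_mat_diag) (auto simp: unitary_mat_def)
  also have "\<dots> = 1\<^sub>m (Suc m)"
    by (intro eq_matI) auto
  finally show ?thesis using U by (auto simp: unitary_mat_def)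
qed

text \<open>Deflation along the list of roots: an eigenvector for the first root becomes the first
  column of a unitary \<open>W\<close>, and conjugation by \<open>W\<close> clears the first column
  below the diagonal. Hermitian symmetry clears the first row too, and the remaining block is
  Hermitian with the remaining roots. The list may come in any order, and the diagonal follows that
  order.\<close>

lemma hermitian_unitary_diagonalization:
  assumes "hermitian_mat n A" and "char_poly A = (\<Prod>e\<leftarrow>es. [:- complex_of_real e, 1:])"
  shows "\<exists>U. unitary_mat n U \<and> A = U * rdiag_mat n ((!) es) * cadj U"
  using assms
proof (induct es arbitrary: n A)
  case Nil
  then have "A \<in> carrier_mat n n" by (auto simp: hermitian_mat_def)
  with degree_monic_char_poly[of A n] Nil have [simp]: "n = 0" by auto
  have "A = 1\<^sub>m 0 * rdiag_mat n ((!) []) * cadj (1\<^sub>m 0)"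
    using \<open>A \<in> carrier_mat n n\<close> by (intro eq_matI) auto
  moreover have "unitary_mat n (1\<^sub>m 0)"
    by (auto simp: unitary_mat_def intro!: eq_matI)
  ultimately show ?case by blast
next
  case (Cons e es n A)
  then have A: "A \<in> carrier_mat n n" and herm: "cadj A = A" by (auto simp: hermitian_mat_def)
  have cp: "char_poly A = [:- complex_of_real e, 1:] * (\<Prod>e\<leftarrow>es. [:- complex_of_real e, 1:])"
    using Cons(3) by simp
  have "eigenvalue A (complex_of_real e)"
    unfolding eigenvalue_root_char_poly[OF A] cp by simp
  then obtain v where v: "v \<in> carrier_vec n" "v \<noteq> 0\<^sub>v n" and ev: "A *\<^sub>v v = complex_of_real e \<cdot>\<^sub>v v"
    using A by (auto simp: eigenvalue_def eigenvector_def)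
  from v have n0: "0 < n" by (cases n) auto
  then obtain m where n: "n = Suc m" by (cases n) auto
  obtain W c where W: "unitary_mat n W" and col: "col W 0 = c \<cdot>\<^sub>v v"
    using ex_unitary_mat_first_col[OF v] .
  note Wc [simp] = unitary_mat_carrier[OF W] and [simp] = A
    and assoc = assoc_mult_mat[of _ n n _ n _ n]
  define A' where "A' = cadj W * A * W"
  have A' [simp]: "A' \<in> carrier_mat n n" by (simp add: A'_def)
  have AW: "A = W * A' * cadj W"
    using mult_cadj_cancel(2)[OF W, of _ n] unitary_mat_right_inverse[OF W]
    by (simp add: A'_def assoc right_mult_one_mat[of _ n])
  have herm': "cadj A' = A'"
    by (simp add: A'_def cadj_mult[of _ n n _ n] assoc herm)
  \<comment> \<open>The first column of \<open>W\<close> is a multiple of the eigenvector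
    \<open>v\<close>, so the first column of \<open>A'\<close> is \<open>e\<close> times the first
    column of \<open>cadj W * W\<close>, a unit vector.\<close>
  have "col A' 0 = cadj W *\<^sub>v (A *\<^sub>v col W 0)"
    using n0 by (simp add: A'_def col_mult2[of _ n n _ n] assoc_mult_mat_vec[of _ n n _ n]
        col_carrier_vec[of _ n _ n])
  also have "A *\<^sub>v col W 0 = complex_of_real e \<cdot>\<^sub>v col W 0"
    using v by (simp add: col ev mult_mat_vec[of _ n n] smult_smult_assoc mult.commute)
  also have "cadj W *\<^sub>v (complex_of_real e \<cdot>\<^sub>v col W 0) =
      complex_of_real e \<cdot>\<^sub>v col (cadj W * W) 0"
    using n0 by (simp add: mult_mat_vec[of _ n n] col_mult2[of _ n n _ n] col_carrier_vec[of _ n _ n])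
  also have "cadj W * W = 1\<^sub>m n" using W by (simp add: unitary_mat_def)
  finally have col0: "A' $$ (i,0) = (if i = 0 then complex_of_real e else 0)" if "i < n" for i
    using that n A' by (auto simp: vec_eq_iff col_def)
  have row0: "A' $$ (0,i) = (if i = 0 then complex_of_real e else 0)" if "i < n" for i
    using index_cadj[of 0 A' i] col0[OF that] herm' that n carrier_matD[OF A'] by (auto split: if_splits)
  define A3 where "A3 = mat m m (\<lambda>(i,j). A' $$ (Suc i, Suc j))"
  have A3 [simp]: "A3 \<in> carrier_mat m m" by (simp add: A3_def)
  have block: "A' = four_block_mat (mat 1 1 (\<lambda>_. complex_of_real e)) (0\<^sub>m 1 m) (0\<^sub>m m 1) A3"
    (is "_ = ?R")
  proof (rule eq_matI)
    fix i j assume "i < dim_row ?R" "j < dim_col ?R"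
    then have ij: "i < n" "j < n" by (auto simp: n A3_def)
    then show "A' $$ (i,j) = ?R $$ (i,j)"
      using col0[OF ij(1)] row0[OF ij(2)] by (cases i; cases j) (auto simp: n A3_def)
  qed (use carrier_matD[OF A'] in \<open>auto simp: n A3_def\<close>)
  have "hermitian_mat m A3"
    unfolding hermitian_mat_def
  proof
    show "cadj A3 = A3"
    proof (rule eq_matI)
      fix i j assume "i < dim_row A3" "j < dim_col A3"
      then have ij: "i < m" "j < m" by (auto simp: A3_def)
      then have "cadj A' $$ (Suc i, Suc j) = cnj (A' $$ (Suc j, Suc i))"
        using carrier_matD[OF A'] n by (intro index_cadj) auto
      then show "cadj A3 $$ (i,j) = A3 $$ (i,j)"
        using ij herm' by (simp add: A3_def)
    qed (auto simp: A3_def)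
  qed simp
  \<comment> \<open>Similarity preserves the characteristic polynomial and the block form splits off
    the linear factor of \<open>e\<close>; cancelling it leaves the roots \<open>es\<close>.\<close>
  moreover have "char_poly A3 = (\<Prod>e\<leftarrow>es. [:- complex_of_real e, 1:])"
  proof -
    have "similar_mat_wit A A' W (cadj W)"
      using W AW by (intro similar_mat_witI[of _ _ n]) (auto simp: unitary_mat_def unitary_mat_right_inverse)
    then have "char_poly A = char_poly A'"
      using char_poly_similar similar_mat_def by blast
    also have "\<dots> = char_poly (mat 1 1 (\<lambda>_. complex_of_real e)) * char_poly A3"
      unfolding block by (rule char_poly_four_block_zeros_col) auto
    also have "char_poly (mat 1 1 (\<lambda>_. complex_of_real e)) = [:- complex_of_real e, 1:]"
      by (simp add: char_poly_defs det_def sign_def)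
    finally show ?thesis
      unfolding cp by (metis mult_cancel_left pCons_eq_0_iff zero_neq_one)
  qed
  ultimately obtain U where U: "unitary_mat m U" and A3eq: "A3 = U * rdiag_mat m ((!) es) * cadj U"
    using Cons(1) by blast
  note Uc [simp] = unitary_mat_carrier[OF U]
  \<comment> \<open>Bordering \<open>U\<close> by a 1 leaves the eigenvalue \<open>e\<close> in the
    corner untouched and diagonalises the rest, so \<open>W * X\<close> diagonalises
    \<open>A\<close>.\<close>
  define X where "X = four_block_mat (1\<^sub>m 1) (0\<^sub>m 1 m) (0\<^sub>m m 1) U"
  have X: "unitary_mat n X" using unitary_mat_four_block[OF U] by (simp add: n X_def)
  note [simp] = unitary_mat_carrier[OF X]
  have diag: "rdiag_mat n ((!) (e # es)) =
      four_block_mat (mat 1 1 (\<lambda>_. complex_of_real e)) (0\<^sub>m 1 m) (0\<^sub>m m 1) (rdiag_mat m ((!) es))"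
    using n by (intro eq_matI) (auto simp: rdiag_mat_def)
  have "X * rdiag_mat n ((!) (e # es)) * cadj X = A'"
    unfolding diag X_def cadj_four_block_mat_diag[OF Uc] block A3eq
    by (simp add: mult_four_block_mat_diag)
  then have "A = W * (X * rdiag_mat n ((!) (e # es)) * cadj X) * cadj W"
    using AW by simp
  also have "\<dots> = (W * X) * rdiag_mat n ((!) (e # es)) * cadj (W * X)"
    by (simp add: cadj_mult[of _ n n _ n] assoc)
  finally show ?case using unitary_mat_mult[OF W X] by blast
qed

section \<open>The decreasing list of eigenvalues\<close>

text \<open>Links the root multiplicities in the definition of \<open>eigs_desc\<close> to counts in
  a list of roots.\<close>

lemma order_prod_linear_factors:
  "Polynomial.order x (\<Prod>e\<leftarrow>es. [:- e, 1:]) = count (mset es) (x :: complex)"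
proof (induct es)
  case (Cons e es)
  have "(\<Prod>e\<leftarrow>es. [:- e, 1:]) \<noteq> 0"
    by (auto simp: prod_list_zero_iff)
  then have "Polynomial.order x (\<Prod>e\<leftarrow>e # es. [:- e, 1:]) =
      Polynomial.order x [:- e, 1:] + Polynomial.order x (\<Prod>e\<leftarrow>es. [:- e, 1:])"
    by (simp add: order_mult del: mult_pCons_left)
  moreover have "Polynomial.order x [:- e, 1:] = (if e = x then 1 else 0)"
    using order_power_n_n[of x 1] by (auto intro: order_0I)
  ultimately show ?case using Cons by simp
qed simp

text \<open>The characteristic polynomial splits over the complex numbers and its roots are real, so
  sorting them gives a list as described. It is unique because a decreasing list is determined by
  its multiset. Later arguments use \<open>eigs_desc\<close> only through these three facts.\<close>

lemma hermitian_eigs_desc: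
  assumes A: "hermitian_mat n A"
  shows "length (eigs_desc n A) = n" (is ?len)
    and "sorted_wrt (\<ge>) (eigs_desc n A)" (is ?sorted)
    and "char_poly A = (\<Prod>e\<leftarrow>eigs_desc n A. [:- complex_of_real e, 1:])" (is ?cp)
proof -
  have Ac: "A \<in> carrier_mat n n" using A by (simp add: hermitian_mat_def)
  obtain as where as: "char_poly A = (\<Prod>a\<leftarrow>as. [:- a, 1:])" and len: "length as = n"
    using char_poly_factorized[OF Ac] by blast
  have real: "complex_of_real (Re a) = a" if "a \<in> set as" for a
  proof -
    have "poly (char_poly A) a = 0"
      unfolding as using that by (auto simp: poly_prod_list prod_list_zero_iff)
    then have "a \<in> \<real>"
      using hermitian_eigenvalue_real[OF A] eigenvalue_root_char_poly[OF Ac] by blast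
    then show ?thesis by (simp add: complex_is_Real_iff complex_eq_iff)
  qed
  define xs where "xs = rev (sort (map Re as))"
  have mset_xs: "mset (map complex_of_real xs) = mset as"
  proof -
    have "mset (map complex_of_real xs) = image_mset (\<lambda>a. complex_of_real (Re a)) (mset as)"
      by (simp add: xs_def multiset.map_comp o_def)
    also have "\<dots> = mset as"
      using real by (metis (no_types, lifting) image_mset_cong multiset.map_ident set_mset_mset)
    finally show ?thesis .
  qed
  have cp: "char_poly A = (\<Prod>e\<leftarrow>xs. [:- complex_of_real e, 1:])"
  proof -
    have "mset (map (\<lambda>a. [:- a, 1:]) as) = mset (map (\<lambda>e. [:- complex_of_real e, 1:]) xs)"
      using arg_cong[OF mset_xs, of "image_mset (\<lambda>a. [:- a, 1:])"] by (simp add: multiset.map_comp o_def)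
    then show ?thesis unfolding as by (metis prod_mset_prod_list)
  qed
  have count: "count (mset xs) x = Polynomial.order (complex_of_real x) (char_poly A)" for x
  proof -
    have "Polynomial.order (complex_of_real x) (char_poly A) =
        count (mset (map complex_of_real xs)) (complex_of_real x)"
      using order_prod_linear_factors[of "complex_of_real x" as] as mset_xs by simp
    also have "\<dots> = count (mset xs) x"
      by (induct xs) auto
    finally show ?thesis by simp
  qed
  have srt: "sorted_wrt (\<ge>) xs"
    by (simp add: xs_def sorted_wrt_rev)
  have "eigs_desc n A = xs"
    unfolding eigs_desc_def
  proof (rule the_equality)
    fix ys assume ys: "length ys = n \<and> sorted_wrt (\<ge>) ys \<and>
      (\<forall>x. count (mset ys) x = Polynomial.order (complex_of_real x) (char_poly A))"
    then have "mset ys = mset xs" using count by (intro multiset_eqI) simp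
    moreover have "sorted (rev ys)" "sorted (rev xs)"
      using ys srt by (auto simp: sorted_wrt_rev)
    ultimately have "rev ys = rev xs"
      by (metis mset_rev properties_for_sort)
    then show "ys = xs" by simp
  qed (use len srt count in \<open>auto simp: xs_def\<close>)
  then show ?len ?sorted ?cp using len srt cp by (auto simp: xs_def)
qed

section \<open>Positive definite matrices, congruence and eigenvalues\<close>

lemma posdef_matsD:
  assumes "A \<in> posdef_mats n"
  shows "hermitian_mat n A" "A \<in> carrier_mat n n" "cadj A = A"
    "\<And>v. v \<in> carrier_vec n \<Longrightarrow> v \<noteq> 0\<^sub>v n \<Longrightarrow> Re (conjugate v \<bullet> (A *\<^sub>v v)) > 0"
  using assms by (auto simp: posdef_mats_def hermitian_mat_def)

text \<open>In the coordinates \<open>cadj U *\<^sub>v v\<close>, which do not all vanish since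
  \<open>U\<close> is invertible, the form is a sum of squared moduli with positive weights.\<close>

lemma posdef_unitary_diag:
  assumes U: "unitary_mat n U" and d: "\<And>i. i < n \<Longrightarrow> d i > 0"
  shows "U * rdiag_mat n d * cadj U \<in> posdef_mats n"
proof -
  note [simp] = unitary_mat_carrier[OF U]
  have "Re (conjugate v \<bullet> ((U * rdiag_mat n d * cadj U) *\<^sub>v v)) > 0"
    if v: "v \<in> carrier_vec n" "v \<noteq> 0\<^sub>v n" for v
  proof -
    define z where "z = cadj U *\<^sub>v v"
    have z: "z \<in> carrier_vec n" using v by (simp add: z_def)
    have "U *\<^sub>v z = v"
      using v U unitary_mat_right_inverse[OF U]
      by (simp add: z_def flip: assoc_mult_mat_vec[of _ n n _ n])
    then have "z \<noteq> 0\<^sub>v n" using v mult_mat_zero_vec[of U n n] by auto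
    then obtain i where i: "i < n" "z $ i \<noteq> 0"
      using z by (metis carrier_vecD eq_vecI index_zero_vec)
    have "0 < (\<Sum>i<n. d i * (cmod (z $ i))\<^sup>2)"
      using i d by (intro sum_pos2[of _ i]) (auto intro!: mult_nonneg_nonneg simp: less_imp_le)
    then show ?thesis
      using cscalar_prod_unitary_diag[OF U v(1), of d] by (simp add: z_def)
  qed
  then show ?thesis
    using hermitian_unitary_diag[OF U] by (auto simp: posdef_mats_def)
qed

lemma cscalar_prod_congruence:
  assumes "B \<in> carrier_mat n n" "S \<in> carrier_mat n n" "cadj S = S" "v \<in> carrier_vec n"
  shows "conjugate v \<bullet> ((S * B * S) *\<^sub>v v) = conjugate (S *\<^sub>v v) \<bullet> (B *\<^sub>v (S *\<^sub>v v))"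
proof -
  have "(S * B * S) *\<^sub>v v = S *\<^sub>v (B *\<^sub>v (S *\<^sub>v v))"
    using assms by (simp add: assoc_mult_mat_vec[of _ n n _ n] del: assoc_mult_mat_vec)
  then show ?thesis
    using assms cscalar_prod_mult_mat_vec[of S n n v "B *\<^sub>v (S *\<^sub>v v)"] by simp
qed

text \<open>Congruence by a Hermitian \<open>S\<close> substitutes \<open>S *\<^sub>v v\<close> for
  \<open>v\<close> in the form; the left inverse \<open>R\<close> keeps this vector nonzero.\<close>

lemma posdef_congruence:
  assumes B: "B \<in> posdef_mats n" and S: "S \<in> carrier_mat n n" "cadj S = S"
    and R: "R \<in> carrier_mat n n" "R * S = 1\<^sub>m n"
  shows "S * B * S \<in> posdef_mats n"
proof -
  note B' [simp] = posdef_matsD(2)[OF B] and [simp] = S R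
  have "Re (conjugate v \<bullet> ((S * B * S) *\<^sub>v v)) > 0" if v: "v \<in> carrier_vec n" "v \<noteq> 0\<^sub>v n" for v
  proof -
    have "R *\<^sub>v (S *\<^sub>v v) = v"
      using v by (simp flip: assoc_mult_mat_vec[of _ n n _ n])
    then have "S *\<^sub>v v \<noteq> 0\<^sub>v n" using v mult_mat_zero_vec[of R n n] by auto
    then show ?thesis
      using cscalar_prod_congruence[OF B' S v(1)] posdef_matsD(4)[OF B, of "S *\<^sub>v v"] v by simp
  qed
  moreover have "hermitian_mat n (S * B * S)"
    by (simp add: hermitian_mat_def cadj_mult[of _ n n _ n] posdef_matsD(3)[OF B]
        assoc_mult_mat[of _ n n _ n _ n])
  ultimately show ?thesis by (simp add: posdef_mats_def)
qed

text \<open>The weights are the squared moduli in one column of the unitary matrix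
  \<open>cadj V * U\<close>, so the value is a convex combination of the \<open>d i\<close>. For
  \<open>U = V\<close> it is \<open>d j\<close> itself.\<close>

lemma cscalar_prod_unitary_diag_col:
  assumes U: "unitary_mat n U" and V: "unitary_mat n V" and j: "j < n"
  shows "conjugate (col U j) \<bullet> ((V * rdiag_mat n d * cadj V) *\<^sub>v col U j) =
    of_real (\<Sum>i<n. d i * (cmod ((cadj V * U) $$ (i,j)))\<^sup>2)"
proof -
  note [simp] = unitary_mat_carrier[OF U] unitary_mat_carrier[OF V]
  have "col U j \<in> carrier_vec n" using j by (intro col_carrier_vec[of _ n]) auto
  moreover have "cadj V *\<^sub>v col U j = col (cadj V * U) j"
    using j by (simp add: col_mult2[of _ n n _ n])
  moreover have "col (cadj V * U) j $ i = (cadj V * U) $$ (i,j)" if "i < n" for i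
    using j that carrier_matD[OF unitary_mat_carrier[OF U]] carrier_matD[OF unitary_mat_carrier[OF V]]
    by simp
  ultimately show ?thesis
    using cscalar_prod_unitary_diag[OF V, of "col U j" d] by simp
qed

text \<open>Evaluating the form at the columns of \<open>U\<close> returns the eigenvalues; they are
  positive because columns of norm 1 are nonzero.\<close>

lemma posdef_diagonalization:
  assumes A: "A \<in> posdef_mats n"
  obtains U where "unitary_mat n U" "A = U * rdiag_mat n ((!) (eigs_desc n A)) * cadj U"
    "\<And>j. j < n \<Longrightarrow> Re (conjugate (col U j) \<bullet> (A *\<^sub>v col U j)) = eigs_desc n A ! j"
    "\<And>j. j < n \<Longrightarrow> 0 < eigs_desc n A ! j"
proof -
  note herm = posdef_matsD(1)[OF A]
  obtain U where U: "unitary_mat n U" and AU: "A = U * rdiag_mat n ((!) (eigs_desc n A)) * cadj U"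
    using hermitian_unitary_diagonalization[OF herm hermitian_eigs_desc(3)[OF herm]] by blast
  have UU: "cadj U * U = 1\<^sub>m n" using U by (simp add: unitary_mat_def)
  have eig: "Re (conjugate (col U j) \<bullet> (A *\<^sub>v col U j)) = eigs_desc n A ! j" if "j < n" for j
  proof -
    have "Re (conjugate (col U j) \<bullet> (A *\<^sub>v col U j)) =
        (\<Sum>i<n. eigs_desc n A ! i * (cmod (1\<^sub>m n $$ (i,j)))\<^sup>2)"
      using cscalar_prod_unitary_diag_col[OF U U that, of "(!) (eigs_desc n A)"] AU UU by simp
    also have "\<dots> = (\<Sum>i<n. if i = j then eigs_desc n A ! j else 0)"
      using that by (intro sum.cong) auto
    also have "\<dots> = eigs_desc n A ! j" using that by simp
    finally show ?thesis .
  qed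
  have "0 < eigs_desc n A ! j" if j: "j < n" for j
  proof -
    have "col U j \<in> carrier_vec n" using j U by (intro col_carrier_vec[of _ n] unitary_mat_carrier)
    moreover have "col U j \<noteq> 0\<^sub>v n"
    proof
      assume "col U j = 0\<^sub>v n"
      then have "U $$ (i,j) = 0" if "i < n" for i
        using that j unitary_mat_carrier[OF U] by (metis carrier_matD index_col index_zero_vec(1))
      then show False using unitary_mat_col_norm[OF U j] by simp
    qed
    ultimately show ?thesis using posdef_matsD(4)[OF A] eig[OF j] by metis
  qed
  then show thesis using that U AU eig by blast
qed

section \<open>The operator arithmetic-geometric mean inequality\<close>

text \<open>Weighted arithmetic-geometric mean inequality for 1 and \<open>c\<close>, from convexity
  of \<open>exp\<close> between 0 and \<open>ln c\<close>.\<close>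

lemma powr_le_affine:
  fixes c t :: real
  assumes "c > 0" "0 \<le> t" "t \<le> 1"
  shows "c powr t \<le> (1 - t) + t * c"
  using convex_onD[OF exp_convex, of t 0 "ln c"] assms by (simp add: powr_def)

text \<open>The operator arithmetic--geometric mean inequality \<open>A #\<^sub>t B \<le> (1 - t) A + t B\<close>: after the
  congruence by \<open>A\<^sup>1\<^sup>/\<^sup>2\<close> it is \<open>C\<^sup>t \<le> (1 - t) I + t C\<close>, which holds eigenvalue by eigenvalue.\<close>

lemma geo_posdef_le_arith:
  assumes A: "A \<in> posdef_mats n" and B: "B \<in> posdef_mats n" and t: "0 \<le> t" "t \<le> 1"
  shows "geo n t A B \<in> posdef_mats n"
    and "\<And>v. v \<in> carrier_vec n \<Longrightarrow> Re (conjugate v \<bullet> (geo n t A B *\<^sub>v v)) \<le>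
      (1 - t) * Re (conjugate v \<bullet> (A *\<^sub>v v)) + t * Re (conjugate v \<bullet> (B *\<^sub>v v))"
proof -
  obtain U where U: "unitary_mat n U" and AU: "A = U * rdiag_mat n ((!) (eigs_desc n A)) * cadj U"
    and d: "\<And>j. j < n \<Longrightarrow> 0 < eigs_desc n A ! j"
    using posdef_diagonalization[OF A] by metis
  define d where "d = (!) (eigs_desc n A)"
  note d = d[folded d_def] and AU = AU[folded d_def]
  note Uc [simp] = unitary_mat_carrier[OF U]
  \<comment> \<open>\<open>T s\<close> is the power of \<open>A\<close> with exponent
    \<open>s\<close> in one fixed eigenbasis, so the identities between square roots and inverses
    all follow from adding exponents.\<close>
  define T where "T s = U * rdiag_mat n (\<lambda>i. d i powr s) * cadj U" for s
  have T [simp]: "T s \<in> carrier_mat n n" "cadj (T s) = T s" for s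
    using hermitian_unitary_diag[OF U] by (auto simp: T_def hermitian_mat_def)
  have T_eq: "mat_powr n A s = T s" for s
    unfolding T_def by (subst AU) (rule mat_powr_unitary_diag[OF U d])
  have T_mult: "T r * T s = T (r + s)" for r s
  proof -
    have "T r * T s = U * (rdiag_mat n (\<lambda>i. d i powr r) * rdiag_mat n (\<lambda>i. d i powr s)) * cadj U"
      using mult_cadj_cancel(1)[OF U, of _ n]
      by (simp add: T_def assoc_mult_mat[of _ n n _ n _ n])
    then show ?thesis by (simp add: rdiag_mat_mult T_def powr_add)
  qed
  have rdiag_cong: "rdiag_mat n f = rdiag_mat n g" if "\<And>i. i < n \<Longrightarrow> f i = g i" for f g
    using that by (intro eq_matI) (auto simp: rdiag_mat_def)
  have rdiag_1: "rdiag_mat n (\<lambda>i. 1) = 1\<^sub>m n"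
    by (intro eq_matI) (auto simp: rdiag_mat_def)
  have T1: "T 1 = A"
    unfolding T_def AU using d by (subst rdiag_cong[of "\<lambda>i. d i powr 1" d]) (auto simp: less_imp_le)
  have T0: "T 0 = 1\<^sub>m n"
  proof -
    \<comment> \<open>Positivity matters here, as \<open>0 powr 0\<close> is 0.\<close>
    have "d i powr 0 = 1" if "i < n" for i
      using d[OF that] by simp
    then show ?thesis
      unfolding T_def using unitary_mat_right_inverse[OF U]
      by (subst rdiag_cong[of "\<lambda>i. d i powr 0" "\<lambda>i. 1"])
        (auto simp: rdiag_1 right_mult_one_mat[of _ n])
  qed
  have RS: "T (-1/2) * T (1/2) = 1\<^sub>m n" and SR: "T (1/2) * T (-1/2) = 1\<^sub>m n"
    and SS: "T (1/2) * T (1/2) = A"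
    using T0 T1 by (simp_all add: T_mult)
  note Bc [simp] = posdef_matsD(2)[OF B]
  define C where "C = T (-1/2) * B * T (-1/2)"
  have C: "C \<in> posdef_mats n"
    unfolding C_def by (rule posdef_congruence[OF B T T(1) SR])
  note Cc [simp] = posdef_matsD(2)[OF C]
  obtain V where V: "unitary_mat n V" and CV: "C = V * rdiag_mat n ((!) (eigs_desc n C)) * cadj V"
    and e: "\<And>j. j < n \<Longrightarrow> 0 < eigs_desc n C ! j"
    using posdef_diagonalization[OF C] by metis
  define e where "e = (!) (eigs_desc n C)"
  note e = e[folded e_def] and CV = CV[folded e_def]
  define P where "P = V * rdiag_mat n (\<lambda>i. e i powr t) * cadj V"
  have "mat_powr n C t = P"
    unfolding P_def by (subst CV) (rule mat_powr_unitary_diag[OF V e])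
  then have G: "geo n t A B = T (1/2) * P * T (1/2)"
    by (simp add: geo_def T_eq C_def)
  have "P \<in> posdef_mats n"
    unfolding P_def by (rule posdef_unitary_diag[OF V]) (metis e less_irrefl powr_gt_zero)
  note Pc = posdef_matsD(2)[OF this]
  show "geo n t A B \<in> posdef_mats n"
    unfolding G by (rule posdef_congruence[OF \<open>P \<in> posdef_mats n\<close> T T(1) RS])
  fix v :: "complex vec" assume v: "v \<in> carrier_vec n"
  \<comment> \<open>In the coordinates \<open>z\<close> all three forms are diagonal:
    \<open>A\<close> has weights 1, \<open>B\<close> has weights \<open>e i\<close>, and the
    geodesic point has weights \<open>e i powr t\<close>.\<close>
  define y where "y = T (1/2) *\<^sub>v v"
  have y: "y \<in> carrier_vec n" using v by (simp add: y_def)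
  define z where "z = cadj V *\<^sub>v y"
  note Vc [simp] = unitary_mat_carrier[OF V]
  have qA: "(\<Sum>i<n. 1 * (cmod (z $ i))\<^sup>2) = Re (conjugate v \<bullet> (A *\<^sub>v v))"
  proof -
    have "conjugate v \<bullet> (A *\<^sub>v v) = conjugate y \<bullet> (1\<^sub>m n *\<^sub>v y)"
      using cscalar_prod_congruence[OF one_carrier_mat T v, of "1/2"] SS right_mult_one_mat[OF T(1)]
      by (simp add: y_def)
    also have "1\<^sub>m n = V * rdiag_mat n (\<lambda>i. 1) * cadj V"
      using unitary_mat_right_inverse[OF V] by (simp add: rdiag_1 right_mult_one_mat[of _ n])
    finally show ?thesis
      using cscalar_prod_unitary_diag[OF V y, of "\<lambda>i. 1"] by (simp add: z_def)
  qed
  have qB: "(\<Sum>i<n. e i * (cmod (z $ i))\<^sup>2) = Re (conjugate v \<bullet> (B *\<^sub>v v))"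
  proof -
    have "T (1/2) * C * T (1/2) = (T (1/2) * T (-1/2)) * B * (T (-1/2) * T (1/2))"
      unfolding C_def by (simp only: assoc_mult_mat[of _ n n _ n _ n] T Bc mult_carrier_mat_square)
    also have "\<dots> = B" by (simp only: SR RS left_mult_one_mat[OF Bc] right_mult_one_mat[OF Bc])
    finally have "conjugate v \<bullet> (B *\<^sub>v v) = conjugate y \<bullet> (C *\<^sub>v y)"
      using cscalar_prod_congruence[OF Cc T v, of "1/2"] by (simp add: y_def)
    then show ?thesis
      using cscalar_prod_unitary_diag[OF V y, of e] CV by (simp add: z_def)
  qed
  have "Re (conjugate v \<bullet> (geo n t A B *\<^sub>v v)) = (\<Sum>i<n. e i powr t * (cmod (z $ i))\<^sup>2)"
    unfolding G cscalar_prod_congruence[OF Pc T v]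
    using cscalar_prod_unitary_diag[OF V y, of "\<lambda>i. e i powr t"]
    by (simp add: y_def z_def P_def)
  also have "\<dots> \<le> (\<Sum>i<n. ((1 - t) + t * e i) * (cmod (z $ i))\<^sup>2)"
    using e t by (intro sum_mono mult_right_mono powr_le_affine) auto
  also have "\<dots> = (1 - t) * (\<Sum>i<n. 1 * (cmod (z $ i))\<^sup>2) + t * (\<Sum>i<n. e i * (cmod (z $ i))\<^sup>2)"
    by (simp only: sum_distrib_left distrib_right sum.distrib mult.assoc mult_1)
  finally show "Re (conjugate v \<bullet> (geo n t A B *\<^sub>v v)) \<le>
      (1 - t) * Re (conjugate v \<bullet> (A *\<^sub>v v)) + t * Re (conjugate v \<bullet> (B *\<^sub>v v))"
    unfolding qA qB .
qed

section \<open>Majorization of quadratic forms by the top eigenvalues\<close>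

text \<open>Subtract the threshold \<open>c\<close>, the \<open>k\<close>-th largest value. Below
  index \<open>k\<close> the differences are nonnegative and \<open>w i \<le> 1\<close> helps; from
  \<open>k\<close> on they are nonpositive and \<open>0 \<le> w i\<close> helps. The total mass
  \<open>k\<close> makes the subtracted amount \<open>k * c\<close> on both sides.\<close>

lemma sum_weighted_le_sum_top:
  fixes w x :: "nat \<Rightarrow> real"
  assumes "1 \<le> k" "k \<le> n" and anti: "\<And>i j. i \<le> j \<Longrightarrow> j < n \<Longrightarrow> x j \<le> x i"
    and w: "\<And>i. i < n \<Longrightarrow> 0 \<le> w i" "\<And>i. i < n \<Longrightarrow> w i \<le> 1" and sum: "(\<Sum>i<n. w i) = real k"
  shows "(\<Sum>i<n. w i * x i) \<le> (\<Sum>i<k. x i)"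
proof -
  define c where "c = x (k - 1)"
  have "(\<Sum>i<n. w i * (x i - c)) \<le> (\<Sum>i<n. if i < k then x i - c else 0)"
  proof (rule sum_mono)
    fix i assume "i \<in> {..<n}"
    then have i: "i < n" by simp
    show "w i * (x i - c) \<le> (if i < k then x i - c else 0)"
    proof (cases "i < k")
      case True
      then have "c \<le> x i" using anti[of i "k - 1"] assms(1,2) by (simp add: c_def)
      then show ?thesis using True w(2)[OF i] mult_left_le_one_le[of "x i - c" "w i"] w(1)[OF i] by simp
    next
      case False
      then have "x i \<le> c" using anti[of "k - 1" i] i by (simp add: c_def)
      then show ?thesis using False w(1)[OF i] by (simp add: mult_nonneg_nonpos)
    qed
  qed
  also have "\<dots> = (\<Sum>i<k. x i - c)"
    using assms(2) by (intro sum.mono_neutral_cong_right) auto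
  finally show ?thesis
    using sum by (simp add: right_diff_distrib sum_subtractf flip: sum_distrib_right)
qed

text \<open>A majorization argument of Schur type: the diagonal of \<open>A\<close> in the
  orthonormal basis of columns of \<open>U\<close> arises from the eigenvalues by doubly stochastic
  averaging.\<close>

lemma sum_convex_quadratic_forms_le:
  assumes mono: "mono_on {0<..} h" and conv: "convex_on {0<..} h" and k: "1 \<le> k" "k \<le> n"
    and A: "A \<in> posdef_mats n" and U: "unitary_mat n U"
  shows "(\<Sum>j<k. h (Re (conjugate (col U j) \<bullet> (A *\<^sub>v col U j)))) \<le> (\<Sum>j<k. h (eigs_desc n A ! j))"
proof -
  obtain V where V: "unitary_mat n V" and AV: "A = V * rdiag_mat n ((!) (eigs_desc n A)) * cadj V"
    and d: "\<And>j. j < n \<Longrightarrow> 0 < eigs_desc n A ! j"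
    using posdef_diagonalization[OF A] by metis
  define d where "d = (!) (eigs_desc n A)"
  note d = d[folded d_def] and AV = AV[folded d_def]
  have W: "unitary_mat n (cadj V * U)"
    using unitary_mat_mult[OF unitary_mat_cadj[OF V] U] .
  \<comment> \<open>Column sums of \<open>p\<close> equal to 1 permit Jensen's inequality and give
    total mass \<open>k\<close>; row sums equal to 1 bound the weight that the first
    \<open>k\<close> columns put on each \<open>h (d i)\<close>.\<close>
  define p where "p i j = (cmod ((cadj V * U) $$ (i,j)))\<^sup>2" for i j
  have p: "p i j \<ge> 0" for i j by (simp add: p_def)
  have col: "(\<Sum>i<n. p i j) = 1" if "j < n" for j
    unfolding p_def using unitary_mat_col_norm[OF W that] .
  have row: "(\<Sum>j<n. p i j) = 1" if "i < n" for i
    unfolding p_def using unitary_mat_row_norm[OF W that] .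
  have "h (Re (conjugate (col U j) \<bullet> (A *\<^sub>v col U j))) \<le> (\<Sum>i<n. p i j * h (d i))" if "j < k" for j
  proof -
    have j: "j < n" using that k by simp
    have "Re (conjugate (col U j) \<bullet> (A *\<^sub>v col U j)) = (\<Sum>i<n. p i j *\<^sub>R d i)"
      using cscalar_prod_unitary_diag_col[OF U V j, of d] AV by (simp add: p_def mult.commute)
    then show ?thesis
      using convex_on_sum[OF _ _ conv, of "{..<n}" "\<lambda>i. p i j" d] p col[OF j] d j by force
  qed
  then have "(\<Sum>j<k. h (Re (conjugate (col U j) \<bullet> (A *\<^sub>v col U j)))) \<le> (\<Sum>j<k. \<Sum>i<n. p i j * h (d i))"
    by (intro sum_mono) auto
  also have "\<dots> = (\<Sum>i<n. (\<Sum>j<k. p i j) * h (d i))"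
    by (subst sum.swap) (simp add: sum_distrib_right)
  also have "\<dots> \<le> (\<Sum>i<k. h (d i))"
  proof (rule sum_weighted_le_sum_top[OF k])
    fix i j assume ij: "i \<le> j" "j < n"
    have "sorted_wrt (\<ge>) (eigs_desc n A)" "length (eigs_desc n A) = n"
      using hermitian_eigs_desc posdef_matsD(1)[OF A] by auto
    then have "d j \<le> d i"
      using ij sorted_wrt_nth_less[of "(\<ge>)" "eigs_desc n A" i j] by (cases "i = j") (auto simp: d_def)
    then show "h (d j) \<le> h (d i)"
      using mono d ij by (auto elim!: mono_onD)
  next
    fix i assume i: "i < n"
    have "(\<Sum>j<k. p i j) \<le> (\<Sum>j<n. p i j)"
      using k p by (intro sum_mono2) auto
    then show "(\<Sum>j<k. p i j) \<le> 1" using row[OF i] by simp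
  next
    have "(\<Sum>i<n. \<Sum>j<k. p i j) = (\<Sum>j<k. \<Sum>i<n. p i j)" by (rule sum.swap)
    also have "\<dots> = real k" using col k by simp
    finally show "(\<Sum>i<n. \<Sum>j<k. p i j) = real k" .
  qed (simp add: p sum_nonneg)
  finally show ?thesis by (simp add: d_def)
qed

theorem theorem1:
  fixes h :: "real \<Rightarrow> real" and n k :: nat
  assumes "mono_on {0<..} h" and "convex_on {0<..} h"
    and "1 \<le> k" and "k \<le> n"
  shows "g_convex n (\<lambda>A. \<Sum>j=1..k. h (eigs_desc n A ! (j - 1)))"
  unfolding g_convex_def
proof (intro ballI allI impI)
  fix A B and t :: real
  assume A: "A \<in> posdef_mats n" and B: "B \<in> posdef_mats n" and t: "0 \<le> t \<and> t \<le> 1"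
  \<comment> \<open>Eigenvalues are numbered from 1 in the sum but from 0 in the list.\<close>
  have shift: "(\<Sum>j=1..k. f (j - 1)) = (\<Sum>j<k. f j)" for f :: "nat \<Rightarrow> real"
    by (rule sum.reindex_bij_witness[of _ Suc "\<lambda>j. j - 1"]) auto
  define G where "G = geo n t A B"
  have G: "G \<in> posdef_mats n"
    unfolding G_def using geo_posdef_le_arith(1)[OF A B] t by blast
  \<comment> \<open>The eigenbasis of the geodesic point \<open>G\<close> supplies the test vectors
    for \<open>A\<close> and \<open>B\<close> as well.\<close>
  obtain U where U: "unitary_mat n U"
    and eig: "\<And>j. j < n \<Longrightarrow> Re (conjugate (col U j) \<bullet> (G *\<^sub>v col U j)) = eigs_desc n G ! j"
    and pos: "\<And>j. j < n \<Longrightarrow> 0 < eigs_desc n G ! j"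
    using posdef_diagonalization[OF G] by metis
  define q where "q M j = Re (conjugate (col U j) \<bullet> (M *\<^sub>v col U j))" for M j
  \<comment> \<open>Keeps the arguments of \<open>h\<close> in the half-line on which it is monotone
    and convex.\<close>
  have q_pos: "0 < q M j" if "M \<in> posdef_mats n" "j < n" for M j
  proof -
    have c: "col U j \<in> carrier_vec n"
      using that U by (intro col_carrier_vec[of _ n] unitary_mat_carrier)
    \<comment> \<open>A zero column would make the corresponding eigenvalue of \<open>G\<close>
      zero.\<close>
    have "col U j \<noteq> 0\<^sub>v n"
      using eig[OF that(2)] pos[OF that(2)] posdef_matsD(2)[OF G] by auto
    then show ?thesis using posdef_matsD(4)[OF that(1) c] by (simp add: q_def)
  qed
  have "h (eigs_desc n G ! j) \<le> (1 - t) * h (q A j) + t * h (q B j)" if "j < k" for j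
  proof -
    have j: "j < n" using that assms by simp
    have c: "col U j \<in> carrier_vec n"
      using j U by (intro col_carrier_vec[of _ n] unitary_mat_carrier)
    have "eigs_desc n G ! j \<le> (1 - t) * q A j + t * q B j"
      using geo_posdef_le_arith(2)[OF A B _ _ c, of t] t eig[OF j] by (simp add: q_def G_def)
    then have "h (eigs_desc n G ! j) \<le> h ((1 - t) * q A j + t * q B j)"
      using assms(1) pos[OF j] by (auto elim!: mono_onD)
    also have "\<dots> \<le> (1 - t) * h (q A j) + t * h (q B j)"
      using convex_onD[OF assms(2), of t "q A j" "q B j"] t q_pos[OF A j] q_pos[OF B j] by simp
    finally show ?thesis .
  qed
  then have "(\<Sum>j<k. h (eigs_desc n G ! j)) \<le> (\<Sum>j<k. (1 - t) * h (q A j) + t * h (q B j))"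
    by (intro sum_mono) auto
  also have "\<dots> = (1 - t) * (\<Sum>j<k. h (q A j)) + t * (\<Sum>j<k. h (q B j))"
    by (simp add: sum.distrib sum_distrib_left)
  \<comment> \<open>The columns of \<open>U\<close> need not be eigenvectors of \<open>A\<close> or
    \<open>B\<close>, so majorization is applied to each of the two sums.\<close>
  also have "\<dots> \<le> (1 - t) * (\<Sum>j<k. h (eigs_desc n A ! j)) + t * (\<Sum>j<k. h (eigs_desc n B ! j))"
    using t sum_convex_quadratic_forms_le[OF assms A U] sum_convex_quadratic_forms_le[OF assms B U]
    by (intro add_mono mult_left_mono) (auto simp: q_def)
  finally show "(\<Sum>j=1..k. h (eigs_desc n (geo n t A B) ! (j - 1))) \<le>
      (1 - t) * (\<Sum>j=1..k. h (eigs_desc n A ! (j - 1))) + t * (\<Sum>j=1..k. h (eigs_desc n B ! (j - 1)))"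
    by (simp only: shift[of "\<lambda>j. h (eigs_desc n _ ! j)"] G_def)
qed

end
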